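(* Let $a,b$ be row vectors of length $n$ with entries in $\mathbb{R}_{\max}$, let $H=\{h\in\mathbb{R}_{\max}^n\mid ah\geq bh\}$, and assume that $I:=\operatorname{Supp} a$ and $J:=\operatorname{Supp} b$ satisfy $I\cap J=\emptyset$ and $J\neq\emptyset$. Let $x\in\mathbb{R}_{\max}^n$, $x\notin H$, be such that $d(x,H)<+\infty$. For an element $h\in\mathbb{R}_{\max}^n$ the following assertions are equivalent: 1. $h$ is a best approximation of $x$ in $H$; 2. $ah\geq bh\neq-\infty$ and, for all $k\in[n]$, $$x_k-bx+ah\leq h_k\leq x_k-ax+bh;$$ 3. there exist $\lambda\in\mathbb{R}$ and $i\in\operatorname{Argmax}(a,x)$ such that $$a_i+h_i=\lambda,$$ $$b_j+h_j=\lambda\quad\text{for all } j\in\operatorname{Argmax}(b,x),$$ $$x_k-bx+\lambda\leq h_k\leq (P_H(x))_k-ax+\lambda\quad\text{for all } k\in[n]\setminus\big(\operatorname{Argmax}(b,x)\cup\{i\}\big).$$ Moreover, in this case $\lambda$ is unique, namely $\lambda=ah=bh$.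
   Context: $\mathbb{R}_{\max}=\mathbb{R}\cup\{-\infty\}$ with addition $\oplus=\max$ and multiplication $\otimes=+$; $\overline{\mathbb{R}}=\mathbb{R}\cup\{-\infty,+\infty\}$ with the convention $(-\infty)+(+\infty)=(+\infty)+(-\infty)=-\infty$; $[n]=\{1,\dots,n\}$. For a row vector $a$ and a column vector $h$, $ah:=\max_{i\in[n]}(a_i+h_i)$. $\operatorname{Supp} a:=\{i\in[n]\mid a_i\in\mathbb{R}\}$ and $\operatorname{Argmax}(a,x):=\{i\in[n]\mid a_i+x_i=ax\}$. $x\lambda$ denotes the vector with entries $x_i+\lambda$; $x\backslash y:=\max\{\lambda\in\overline{\mathbb{R}}\mid x\lambda\leq y\}$ (entrywise order). Hilbert's projective distance is $d(x,y):=-\big((x\backslash y)+(y\backslash x)\big)\in\overline{\mathbb{R}}$; $d(x,H):=\inf_{h\in H}d(x,h)$; a best approximation of $x$ in $H$ is an element $h\in H$ with $d(x,h)=d(x,H)$. The canonical projection is $P_H(x):=\max\{h\in H\mid h\leq x\}$. Under the hypotheses on $x$, both $ax$ and $bx$ are finite. *)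

theory Defs
  imports "HOL-Library.Extended_Real"
begin

text \<open>
  Vectors of length \<open>n\<close> are functions from a finite index type \<open>'n\<close> to \<^typ>\<open>ereal\<close>, with the
  pointwise order. The semiring \<open>\<real> \<union> {-\<infinity>}\<close> is the subset \<open>{t. t \<noteq> \<infinity>}\<close> of \<^typ>\<open>ereal\<close>; on it the
  library addition is the max-plus multiplication.
\<close>

definition rmax_vec :: "('n \<Rightarrow> ereal) set" where
  "rmax_vec = {h. \<forall>i. h i \<noteq> \<infinity>}"

text \<open>
  The library has \<open>(-\<infinity>) + \<infinity> = \<infinity>\<close> on \<^typ>\<open>ereal\<close>; here \<open>-\<infinity>\<close> has to be absorbing instead.
\<close>

definition ladd :: "ereal \<Rightarrow> ereal \<Rightarrow> ereal" where
  "ladd s t = (if s = -\<infinity> \<or> t = -\<infinity> then -\<infinity> else s + t)"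

definition mp_dot :: "('n::finite \<Rightarrow> ereal) \<Rightarrow> ('n \<Rightarrow> ereal) \<Rightarrow> ereal"  (infixl "\<odot>" 70) where
  "a \<odot> h = (MAX i. ladd (a i) (h i))"

definition Supp :: "('n \<Rightarrow> ereal) \<Rightarrow> 'n set" where
  "Supp a = {i. a i \<in> range ereal}"

definition Argmax :: "('n::finite \<Rightarrow> ereal) \<Rightarrow> ('n \<Rightarrow> ereal) \<Rightarrow> 'n set" where
  "Argmax a x = {i. ladd (a i) (x i) = a \<odot> x}"

definition scale_vec :: "('n \<Rightarrow> ereal) \<Rightarrow> ereal \<Rightarrow> 'n \<Rightarrow> ereal" where
  "scale_vec x t = (\<lambda>i. ladd (x i) t)"

text \<open>The scalar \<open>t\<close> ranges over all of \<^typ>\<open>ereal\<close>, so the residual may be \<open>\<infinity>\<close> or \<open>-\<infinity>\<close>.\<close>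

definition residual :: "('n \<Rightarrow> ereal) \<Rightarrow> ('n \<Rightarrow> ereal) \<Rightarrow> ereal" where
  "residual x y = (GREATEST t. scale_vec x t \<le> y)"

definition hilbert_dist :: "('n \<Rightarrow> ereal) \<Rightarrow> ('n \<Rightarrow> ereal) \<Rightarrow> ereal" where
  "hilbert_dist x y = - ladd (residual x y) (residual y x)"

definition hilbert_setdist :: "('n \<Rightarrow> ereal) \<Rightarrow> ('n \<Rightarrow> ereal) set \<Rightarrow> ereal" where
  "hilbert_setdist x H = (INF h\<in>H. hilbert_dist x h)"

definition best_approximation ::
    "('n \<Rightarrow> ereal) \<Rightarrow> ('n \<Rightarrow> ereal) set \<Rightarrow> ('n \<Rightarrow> ereal) \<Rightarrow> bool" where
  "best_approximation x H h \<longleftrightarrow> h \<in> H \<and> hilbert_dist x h = hilbert_setdist x H"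

definition canonical_proj :: "('n \<Rightarrow> ereal) set \<Rightarrow> ('n \<Rightarrow> ereal) \<Rightarrow> 'n \<Rightarrow> ereal" where
  "canonical_proj H x = (GREATEST h. h \<in> H \<and> h \<le> x)"

definition mp_halfspace :: "('n::finite \<Rightarrow> ereal) \<Rightarrow> ('n \<Rightarrow> ereal) \<Rightarrow> ('n \<Rightarrow> ereal) set" where
  "mp_halfspace a b = {h \<in> rmax_vec. a \<odot> h \<ge> b \<odot> h}"

end

theory Submission imports Defs begin

text \<open>
  Monotonicity of \<open>h \<mapsto> a \<odot> h\<close> and \<open>h \<mapsto> b \<odot> h\<close> along \<open>x p \<le> h\<close> and \<open>h q \<le> x\<close> gives
  \<open>b x + p + q \<le> b h + q \<le> a h + q \<le> a x\<close>, so no point of the half-space is closer to \<open>x\<close> than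
  \<open>b x - a x\<close>. The projection \<open>P\<close> with entries \<open>min (x k) (a x - b k)\<close> attains this bound, hence
  \<open>h\<close> is a best approximation iff all these inequalities are equalities, which is assertion 2.
\<close>

section \<open>Max-plus products and residuation\<close>

lemma rmax_vecD: "h \<in> rmax_vec \<Longrightarrow> h i \<noteq> \<infinity>"
  by (simp add: rmax_vec_def)

lemma ladd_rmax: "s \<noteq> \<infinity> \<Longrightarrow> t \<noteq> \<infinity> \<Longrightarrow> ladd s t = s + t"
  by (cases s; cases t) (auto simp: ladd_def)

text \<open>The library difference is exactly the residual of the absorbing addition. For
  \<open>s = -\<infinity>\<close> both sides hold: \<open>ladd\<close> absorbs to
  \<open>-\<infinity>\<close>, while \<open>u - s\<close> is \<open>\<infinity>\<close> even for
  \<open>u = -\<infinity>\<close>.\<close>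

lemma ladd_le_iff: "s \<noteq> \<infinity> \<Longrightarrow> ladd s t \<le> u \<longleftrightarrow> t \<le> u - s"
  by (cases s; cases t; cases u) (auto simp: ladd_def)

text \<open>Entrywise residuation turns the admissible scalars into the down-set of a minimum over a
  finite nonempty index type, so the \<open>GREATEST\<close> in \<open>residual\<close> exists and
  is that minimum.\<close>

lemma residual_galois:
  fixes x :: "'n::finite \<Rightarrow> ereal"
  assumes "x \<in> rmax_vec"
  shows "t \<le> residual x y \<longleftrightarrow> (\<forall>k. t \<le> y k - x k)"
proof -
  have scale: "scale_vec x t \<le> y \<longleftrightarrow> t \<le> (MIN k. y k - x k)" for t
    using assms by (simp add: scale_vec_def le_fun_def ladd_le_iff rmax_vecD)
  have "residual x y = (MIN k. y k - x k)"
    unfolding residual_def scale by (rule Greatest_equality) auto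
  then show ?thesis by simp
qed

lemma mp_dot_le_iff:
  fixes a h :: "'n::finite \<Rightarrow> ereal"
  assumes "a \<in> rmax_vec" "h \<in> rmax_vec"
  shows "a \<odot> h \<le> t \<longleftrightarrow> (\<forall>i. a i + h i \<le> t)"
  using assms by (simp add: mp_dot_def ladd_rmax rmax_vecD)

lemma mp_dot_ge:
  fixes a h :: "'n::finite \<Rightarrow> ereal"
  assumes "a \<in> rmax_vec" "h \<in> rmax_vec"
  shows "a i + h i \<le> a \<odot> h"
  using mp_dot_le_iff[OF assms] by blast

lemma Argmax_iff:
  fixes a x :: "'n::finite \<Rightarrow> ereal"
  assumes "a \<in> rmax_vec" "x \<in> rmax_vec"
  shows "i \<in> Argmax a x \<longleftrightarrow> a i + x i = a \<odot> x"
  using assms by (simp add: Argmax_def ladd_rmax rmax_vecD)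

lemma mp_dot_attained:
  fixes a h :: "'n::finite \<Rightarrow> ereal"
  assumes "a \<in> rmax_vec" "h \<in> rmax_vec"
  obtains i where "a i + h i = a \<odot> h"
proof -
  have "a \<odot> h \<in> range (\<lambda>i. ladd (a i) (h i))"
    unfolding mp_dot_def by (rule Max_in) auto
  then show thesis
    using that assms by (auto simp: ladd_rmax rmax_vecD)
qed

lemma mp_dot_not_PInf:
  fixes a h :: "'n::finite \<Rightarrow> ereal"
  assumes "a \<in> rmax_vec" "h \<in> rmax_vec"
  shows "a \<odot> h \<noteq> \<infinity>"
  using mp_dot_attained[OF assms] assms by (metis rmax_vecD plus_ereal.simps(1) ereal_plus_eq_PInfty)

text \<open>It suffices to compare at an index where \<open>a \<odot> u\<close> is attained. With a
  residual as the shift, this transfers entrywise bounds between \<open>x\<close> and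
  \<open>h\<close> to their products with \<open>a\<close> and \<open>b\<close>.\<close>

lemma mp_dot_shift_le:
  fixes a u v :: "'n::finite \<Rightarrow> ereal"
  assumes "a \<in> rmax_vec" "u \<in> rmax_vec" "v \<in> rmax_vec"
    and le: "\<And>k. u k + ereal r \<le> v k"
  shows "a \<odot> u + ereal r \<le> a \<odot> v"
proof -
  obtain i where i: "a i + u i = a \<odot> u"
    using mp_dot_attained[OF assms(1,2)] by blast
  have "a i + (u i + ereal r) \<le> a i + v i"
    using le by (rule add_left_mono)
  also have "\<dots> \<le> a \<odot> v"
    using assms by (intro mp_dot_ge)
  finally show ?thesis
    by (simp add: add.assoc flip: i)
qed

section \<open>Finite Hilbert distance as a pair of real shifts\<close>

lemma hilbert_dist_lessE:
  fixes x h :: "'n::finite \<Rightarrow> ereal"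
  assumes "x \<in> rmax_vec" "h \<in> rmax_vec" "x j \<noteq> -\<infinity>" "hilbert_dist x h < \<infinity>"
  obtains p q where "hilbert_dist x h = ereal (- (p + q))"
    "\<And>k. x k + ereal p \<le> h k" "\<And>k. h k + ereal q \<le> x k"
proof -
  let ?p = "residual x h" and ?q = "residual h x"
  have fin: "?p \<noteq> -\<infinity>" "?q \<noteq> -\<infinity>"
    using assms(4) by (auto simp: hilbert_dist_def ladd_def split: if_splits)
  have p: "?p \<le> h k - x k" for k
    using residual_galois[OF assms(1), of ?p h] by simp
  have q: "?q \<le> x k - h k" for k
    using residual_galois[OF assms(2), of ?q x] by simp
  note rm = rmax_vecD[OF assms(1), of j] rmax_vecD[OF assms(2), of j]
  \<comment> \<open>Finite distance excludes only \<open>-\<infinity>\<close> for the residuals. The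
    finite entry \<open>x j\<close> bounds \<open>?p\<close> away from \<open>\<infinity>\<close>;
    the real \<open>p'\<close> then forces \<open>h j\<close> to be finite, which bounds
    \<open>?q\<close> in turn.\<close>
  obtain p' where p': "?p = ereal p'"
    using fin p[of j] rm assms(3) by (cases ?p; cases "x j"; cases "h j") auto
  obtain q' where q': "?q = ereal q'"
    using fin p[of j] q[of j] p' rm assms(3) by (cases ?q; cases "x j"; cases "h j") auto
  show thesis
  proof
    show "hilbert_dist x h = ereal (- (p' + q'))"
      by (simp add: hilbert_dist_def p' q' ladd_def)
    show "x k + ereal p' \<le> h k" for k
      using p[of k] p' rmax_vecD[OF assms(1), of k] by (cases "x k"; cases "h k") auto
    show "h k + ereal q' \<le> x k" for k
      using q[of k] q' rmax_vecD[OF assms(2), of k] by (cases "x k"; cases "h k") auto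
  qed
qed

lemma hilbert_dist_le:
  fixes x h :: "'n::finite \<Rightarrow> ereal"
  assumes "x \<in> rmax_vec" "h \<in> rmax_vec"
    and "\<And>k. x k + ereal p \<le> h k" "\<And>k. h k + ereal q \<le> x k"
  shows "hilbert_dist x h \<le> ereal (- (p + q))"
proof -
  have "ereal p \<le> h k - x k" "ereal q \<le> x k - h k" for k
    using assms(3,4)[of k] rmax_vecD[OF assms(1), of k] rmax_vecD[OF assms(2), of k]
    by (cases "x k"; cases "h k"; auto)+
  then have "ereal p \<le> residual x h" "ereal q \<le> residual h x"
    using assms(1,2) by (simp_all add: residual_galois)
  then show ?thesis
    by (cases "residual x h"; cases "residual h x") (auto simp: hilbert_dist_def ladd_def)
qed

section \<open>A point outside the half-space and its canonical projection\<close>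

locale excluded_point =
  fixes a b x :: "'n::finite \<Rightarrow> ereal" and \<alpha> \<beta> :: real
  assumes rmax: "a \<in> rmax_vec" "b \<in> rmax_vec" "x \<in> rmax_vec"
    and disjoint: "\<And>k. a k = -\<infinity> \<or> b k = -\<infinity>"
    and ax: "a \<odot> x = ereal \<alpha>" and bx: "b \<odot> x = ereal \<beta>" and less: "\<alpha> < \<beta>"
begin

abbreviation "H \<equiv> mp_halfspace a b"

text \<open>Assertion 2 of the theorem.\<close>

definition optimal :: "('n \<Rightarrow> ereal) \<Rightarrow> bool" where
  "optimal h \<longleftrightarrow> a \<odot> h \<ge> b \<odot> h \<and> b \<odot> h \<noteq> -\<infinity> \<and>
     (\<forall>k. x k - b \<odot> x + a \<odot> h \<le> h k \<and> h k \<le> x k - a \<odot> x + b \<odot> h)"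

text \<open>The conditions of assertion 3 for a given scalar and a given index.\<close>

definition saturated :: "('n \<Rightarrow> ereal) \<Rightarrow> real \<Rightarrow> 'n \<Rightarrow> bool" where
  "saturated h l i \<longleftrightarrow> a i + h i = ereal l \<and>
     (\<forall>j\<in>Argmax b x. b j + h j = ereal l) \<and>
     (\<forall>k\<in>UNIV - (Argmax b x \<union> {i}).
        x k - b \<odot> x + ereal l \<le> h k \<and> h k \<le> canonical_proj H x k - a \<odot> x + ereal l)"

lemma halfspace_iff: "h \<in> H \<longleftrightarrow> h \<in> rmax_vec \<and> b \<odot> h \<le> a \<odot> h"
  by (simp add: mp_halfspace_def)

text \<open>The second term is the largest entry at \<open>k\<close> that keeps its sum with
  \<open>b k\<close> at most \<alpha>. It is \<open>\<infinity>\<close>, hence no constraint, where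
  \<open>b k = -\<infinity>\<close>.\<close>

definition P :: "'n \<Rightarrow> ereal" where
  "P = (\<lambda>k. min (x k) (ereal \<alpha> - b k))"

lemma P_rmax: "P \<in> rmax_vec"
  using rmax by (auto simp: rmax_vec_def P_def min_def)

text \<open>By disjointness \<open>P\<close> can lower \<open>x\<close> only where
  \<open>a k = -\<infinity>\<close>, so the product with \<open>a\<close> keeps its value
  \<alpha>.\<close>

lemma P_eq_on_Supp: "a k \<noteq> -\<infinity> \<Longrightarrow> P k = x k"
  using disjoint[of k] by (simp add: P_def min_def)

lemma a_dot_P: "a \<odot> P = ereal \<alpha>"
proof -
  have "a k + P k = a k + x k" for k
  proof (cases "a k = -\<infinity>")
    case True
    then show ?thesis using rmax_vecD[OF P_rmax, of k] rmax_vecD[OF rmax(3), of k]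
      by (cases "P k"; cases "x k") auto
  qed (simp add: P_eq_on_Supp)
  then show ?thesis
    using ax by (simp add: mp_dot_def ladd_rmax rmax_vecD rmax P_rmax)
qed

lemma P_optimal: "optimal P"
proof -
  have "b k + P k \<le> ereal \<alpha>" for k
    using rmax_vecD[OF rmax(2), of k] rmax_vecD[OF rmax(3), of k]
    by (cases "b k"; cases "x k") (auto simp: P_def min_def)
  then have le: "b \<odot> P \<le> ereal \<alpha>"
    by (simp add: mp_dot_le_iff rmax P_rmax)
  obtain j where j: "b j + x j = ereal \<beta>"
    using mp_dot_attained[OF rmax(2,3)] bx by metis
  \<comment> \<open>Since \<open>b j + x j = \<beta>\<close> exceeds \<alpha>, the minimum at
    \<open>j\<close> is its second term.\<close>
  have "b j + P j = ereal \<alpha>"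
    using j less by (cases "b j"; cases "x j") (auto simp: P_def min_def)
  then have eq: "b \<odot> P = ereal \<alpha>"
    using le mp_dot_ge[OF rmax(2) P_rmax, of j] by simp
  \<comment> \<open>The left side is below \<open>x k\<close> because \<alpha> < \<beta>, and below
    \<open>\<alpha> - b k\<close> because \<open>b k + x k \<le> \<beta>\<close>.\<close>
  have "x k - ereal \<beta> + ereal \<alpha> \<le> P k" for k
    using mp_dot_ge[OF rmax(2,3), of k] bx less rmax_vecD[OF rmax(2), of k]
    by (cases "b k"; cases "x k") (auto simp: P_def min_def)
  moreover have "P k \<le> x k - ereal \<alpha> + ereal \<alpha>" for k
    by (cases "x k") (auto simp: P_def)
  ultimately show ?thesis
    by (simp add: optimal_def a_dot_P eq ax bx)
qed

text \<open>A point \<open>h\<close> of \<open>H\<close> below \<open>x\<close> satisfies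
  \<open>b \<odot> h \<le> a \<odot> h \<le> a \<odot> x = \<alpha>\<close>; residuating by
  \<open>b k\<close> gives the second bound in \<open>P\<close>.\<close>

lemma canonical_proj_eq: "canonical_proj H x = P"
  unfolding canonical_proj_def
proof (rule Greatest_equality)
  show "P \<in> H \<and> P \<le> x"
    using P_optimal P_rmax by (auto simp: halfspace_iff optimal_def le_fun_def P_def)
next
  fix h assume h: "h \<in> H \<and> h \<le> x"
  have "a \<odot> h \<le> ereal \<alpha>"
    using h mp_dot_shift_le[of a h x 0] rmax ax
    by (simp add: halfspace_iff le_fun_def flip: zero_ereal_def)
  then have "b \<odot> h \<le> ereal \<alpha>"
    using h by (auto simp: halfspace_iff)
  then have "b k + h k \<le> ereal \<alpha>" for k
    using h rmax by (simp add: halfspace_iff mp_dot_le_iff)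
  then have "h k \<le> ereal \<alpha> - b k" for k
    using h rmax by (simp add: halfspace_iff rmax_vecD flip: ladd_le_iff ladd_rmax)
  then show "h \<le> P"
    using h by (simp add: le_fun_def P_def)
qed

section \<open>Best approximations and assertion 2\<close>

lemma optimal_finite:
  assumes "h \<in> rmax_vec" "optimal h"
  obtains l where "a \<odot> h = ereal l" "b \<odot> h = ereal l"
proof -
  have opt: "b \<odot> h \<le> a \<odot> h" "b \<odot> h \<noteq> -\<infinity>" "\<And>k. h k \<le> x k - a \<odot> x + b \<odot> h"
    using assms(2) by (auto simp: optimal_def)
  obtain l where l: "b \<odot> h = ereal l"
    using opt(2) mp_dot_not_PInf[OF rmax(2) assms(1)] by (cases "b \<odot> h") auto
  \<comment> \<open>The upper bound of assertion 2, read as a shift of \<open>h\<close> below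
    \<open>x\<close>, yields \<open>a \<odot> h \<le> l\<close> and hence equality of the two
    products.\<close>
  have "h k + ereal (\<alpha> - l) \<le> x k" for k
    using opt(3)[of k] rmax_vecD[OF assms(1), of k] unfolding ax l
    by (cases "x k"; cases "h k") auto
  then have "a \<odot> h + ereal (\<alpha> - l) \<le> ereal \<alpha>"
    using mp_dot_shift_le[OF rmax(1) assms(1) rmax(3)] ax by simp
  then have "a \<odot> h = ereal l"
    using opt(1) l by (cases "a \<odot> h") auto
  then show thesis using that l by blast
qed

lemma x_finite: obtains j where "x j \<noteq> -\<infinity>"
proof -
  obtain j where "b j + x j = ereal \<beta>"
    using mp_dot_attained[OF rmax(2,3)] bx by metis
  then show thesis
    by (intro that[of j]) (cases "b j"; auto)
qed

text \<open>Assuming only an upper bound on the distance lets the second conclusion double as the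
  lower bound \<open>\<beta> - \<alpha>\<close> on all of \<open>H\<close>.\<close>

lemma close_imp_optimal:
  assumes "h \<in> H" "hilbert_dist x h \<le> ereal (\<beta> - \<alpha>)"
  shows "optimal h" "hilbert_dist x h = ereal (\<beta> - \<alpha>)"
proof -
  have h: "h \<in> rmax_vec" "b \<odot> h \<le> a \<odot> h"
    using assms(1) by (auto simp: halfspace_iff)
  obtain j where j: "x j \<noteq> -\<infinity>" by (rule x_finite)
  have "hilbert_dist x h < \<infinity>" using assms(2) by auto
  then obtain p q where pq: "hilbert_dist x h = ereal (- (p + q))"
    "\<And>k. x k + ereal p \<le> h k" "\<And>k. h k + ereal q \<le> x k"
    using hilbert_dist_lessE[OF rmax(3) h(1) j] by metis
  have B: "ereal \<beta> + ereal p \<le> b \<odot> h"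
    using mp_dot_shift_le[OF rmax(2,3) h(1) pq(2)] bx by simp
  have A: "a \<odot> h + ereal q \<le> ereal \<alpha>"
    using mp_dot_shift_le[OF rmax(1) h(1) rmax(3) pq(3)] ax by simp
  obtain u where u: "a \<odot> h = ereal u"
    using A B h(2) by (cases "a \<odot> h"; cases "b \<odot> h") auto
  obtain v where v: "b \<odot> h = ereal v"
    using B u h(2) by (cases "b \<odot> h") auto
  \<comment> \<open>Here \<open>p \<le> v - \<beta>\<close>, \<open>q \<le> \<alpha> - u\<close> and
    \<open>v \<le> u\<close> sum to \<open>p + q \<le> \<alpha> - \<beta>\<close>, while the
    distance bound is the reverse inequality, so none of them is strict.\<close>
  have eqs: "p = v - \<beta>" "q = \<alpha> - u" "u = v"
    using A B h(2) assms(2) unfolding u v pq(1) by auto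
  show "hilbert_dist x h = ereal (\<beta> - \<alpha>)"
    using pq(1) eqs by simp
  have "x k - ereal \<beta> + ereal u \<le> h k \<and> h k \<le> x k - ereal \<alpha> + ereal v" for k
    using pq(2,3)[of k] eqs by (cases "x k"; cases "h k") auto
  then show "optimal h"
    using h(2) by (simp add: optimal_def ax bx u v)
qed

lemma optimal_imp_close:
  assumes "h \<in> rmax_vec" "optimal h"
  shows "h \<in> H" "hilbert_dist x h = ereal (\<beta> - \<alpha>)"
proof -
  show H: "h \<in> H" using assms by (simp add: halfspace_iff optimal_def)
  obtain l where l: "a \<odot> h = ereal l" "b \<odot> h = ereal l"
    using optimal_finite[OF assms] by blast
  have bnd: "x k - ereal \<beta> + ereal l \<le> h k" "h k \<le> x k - ereal \<alpha> + ereal l" for k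
    using assms(2) by (auto simp: optimal_def ax bx l)
  \<comment> \<open>The two shifts sum to \<open>\<alpha> - \<beta>\<close>, whose negative is the
    claimed distance.\<close>
  have "x k + ereal (l - \<beta>) \<le> h k" "h k + ereal (\<alpha> - l) \<le> x k" for k
    using bnd[of k] by (cases "x k"; cases "h k"; auto)+
  then have "hilbert_dist x h \<le> ereal (\<beta> - \<alpha>)"
    using hilbert_dist_le[OF rmax(3) assms(1), of "l - \<beta>" "\<alpha> - l"] by simp
  then show "hilbert_dist x h = ereal (\<beta> - \<alpha>)"
    using close_imp_optimal(2)[OF H] by blast
qed

lemma hilbert_setdist_eq: "hilbert_setdist x H = ereal (\<beta> - \<alpha>)"
  unfolding hilbert_setdist_def
proof (rule antisym)
  show "(INF h\<in>H. hilbert_dist x h) \<le> ereal (\<beta> - \<alpha>)"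
    using optimal_imp_close[OF P_rmax P_optimal] by (metis INF_lower)
  show "ereal (\<beta> - \<alpha>) \<le> (INF h\<in>H. hilbert_dist x h)"
    by (rule INF_greatest) (metis close_imp_optimal(2) linear)
qed

lemma best_approximation_iff_optimal:
  assumes "h \<in> rmax_vec"
  shows "best_approximation x H h \<longleftrightarrow> optimal h"
  unfolding best_approximation_def hilbert_setdist_eq
  using close_imp_optimal(1) optimal_imp_close[OF assms] by auto

section \<open>Assertions 2 and 3\<close>

lemma optimal_imp_saturated:
  assumes "h \<in> rmax_vec" "optimal h"
  shows "\<exists>l. \<exists>i\<in>Argmax a x. saturated h l i"
proof -
  obtain l where l: "a \<odot> h = ereal l" "b \<odot> h = ereal l"
    using optimal_finite[OF assms] by blast
  have bnd: "x k - ereal \<beta> + ereal l \<le> h k" "h k \<le> x k - ereal \<alpha> + ereal l" for k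
    using assms(2) by (auto simp: optimal_def ax bx l)
  obtain i where i: "a i + h i = ereal l"
    using mp_dot_attained[OF rmax(1) assms(1)] l(1) by metis
  \<comment> \<open>An index attaining \<open>a \<odot> h\<close> also attains
    \<open>a \<odot> x\<close>: the upper bound on \<open>h i\<close> gives
    \<open>l \<le> a i + x i - \<alpha> + l\<close>.\<close>
  have "a i + x i = ereal \<alpha>"
    using i bnd(2)[of i] mp_dot_ge[OF rmax(1,3), of i] ax
    by (cases "a i"; cases "x i"; cases "h i") auto
  then have "i \<in> Argmax a x"
    using rmax ax by (simp add: Argmax_iff)
  \<comment> \<open>The lower bound on \<open>h j\<close> gives \<open>b j + h j \<ge> l\<close>,
    and \<open>b \<odot> h = l\<close> gives the converse.\<close>
  moreover have "b j + h j = ereal l" if "j \<in> Argmax b x" for j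
  proof -
    have "b j + x j = ereal \<beta>"
      using that rmax bx by (simp add: Argmax_iff)
    then show ?thesis
      using bnd(1)[of j] mp_dot_ge[OF rmax(2) assms(1), of j] l(2) rmax_vecD[OF assms(1), of j]
      by (cases "b j"; cases "x j"; cases "h j") auto
  qed
  \<comment> \<open>Replacing \<open>x k\<close> by the smaller \<open>P k\<close> is legitimate
    because \<open>b k + h k \<le> l\<close> supplies the bound from the second term of
    \<open>P\<close>.\<close>
  moreover have "h k \<le> P k - ereal \<alpha> + ereal l" for k
    using bnd(2)[of k] mp_dot_ge[OF rmax(2) assms(1), of k] l(2)
      rmax_vecD[OF assms(1), of k] rmax_vecD[OF rmax(2), of k]
    by (cases "b k"; cases "x k"; cases "h k") (auto simp: P_def min_def)
  ultimately show ?thesis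
    using i bnd(1) unfolding saturated_def canonical_proj_eq ax bx by blast
qed

lemma saturated_imp_optimal:
  assumes h: "h \<in> rmax_vec" and i: "i \<in> Argmax a x" and sat: "saturated h l i"
  shows "a \<odot> h = ereal l" "b \<odot> h = ereal l" "optimal h"
proof -
  have ai: "a i + h i = ereal l"
    and bj: "\<And>j. j \<in> Argmax b x \<Longrightarrow> b j + h j = ereal l"
    and rest: "\<And>k. k \<notin> Argmax b x \<Longrightarrow> k \<noteq> i \<Longrightarrow>
      x k - ereal \<beta> + ereal l \<le> h k \<and> h k \<le> P k - ereal \<alpha> + ereal l"
    using sat by (auto simp: saturated_def canonical_proj_eq ax bx)
  have P_le: "P k - ereal \<alpha> + ereal l \<le> x k - ereal \<alpha> + ereal l" for k
    by (intro add_right_mono ereal_minus_mono) (auto simp: P_def)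
  have axi: "a i + x i = ereal \<alpha>"
    using i rmax ax by (simp add: Argmax_iff)
  have bxj: "b j + x j = ereal \<beta>" if "j \<in> Argmax b x" for j
    using that rmax bx by (simp add: Argmax_iff)
  \<comment> \<open>On \<open>Argmax b x\<close> the entry of \<open>b\<close> is finite, so that of
    \<open>a\<close> is \<open>-\<infinity>\<close>. At the remaining indices other than
    \<open>i\<close>, the bound by \<open>P k \<le> x k\<close> is enough.\<close>
  have a_le: "a k + h k \<le> ereal l" for k
  proof -
    consider "k = i" | "k \<in> Argmax b x" | "k \<noteq> i" "k \<notin> Argmax b x" by blast
    then show ?thesis
    proof cases
      case 1
      then show ?thesis using ai by simp
    next
      case 2
      then have "a k = -\<infinity>" using bxj[of k] disjoint[of k] by (cases "x k") auto
      then show ?thesis using rmax_vecD[OF h, of k] by (cases "h k") auto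
    next
      case 3
      then have "h k \<le> x k - ereal \<alpha> + ereal l"
        using rest[of k] P_le by (meson order_trans)
      then show ?thesis
        using mp_dot_ge[OF rmax(1,3), of k] ax rmax_vecD[OF h, of k] rmax_vecD[OF rmax(1), of k]
        by (cases "a k"; cases "x k"; cases "h k") auto
    qed
  qed
  show ah: "a \<odot> h = ereal l"
    using a_le ai mp_dot_ge[OF rmax(1) h, of i] by (intro antisym) (auto simp: mp_dot_le_iff rmax h)
  \<comment> \<open>Now \<open>i\<close> is the index with \<open>b i = -\<infinity>\<close>, and
    elsewhere off \<open>Argmax b x\<close> the term \<open>\<alpha> - b k\<close> in
    \<open>P\<close> gives the bound.\<close>
  have b_le: "b k + h k \<le> ereal l" for k
  proof -
    consider "k = i" | "k \<in> Argmax b x" | "k \<noteq> i" "k \<notin> Argmax b x" by blast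
    then show ?thesis
    proof cases
      case 1
      then have "b k = -\<infinity>" using axi disjoint[of k] by (cases "x k") auto
      then show ?thesis using rmax_vecD[OF h, of k] by (cases "h k") auto
    next
      case 2
      then show ?thesis using bj by simp
    next
      case 3
      then show ?thesis
        using rest[of k] rmax_vecD[OF h, of k] rmax_vecD[OF rmax(2), of k]
        by (cases "b k"; cases "x k"; cases "h k") (auto simp: P_def min_def split: if_splits)
    qed
  qed
  obtain j where "j \<in> Argmax b x"
    using mp_dot_attained[OF rmax(2,3)] Argmax_iff[OF rmax(2,3)] by metis
  then have "ereal l \<le> b \<odot> h"
    using bj mp_dot_ge[OF rmax(2) h, of j] by simp
  then show bh: "b \<odot> h = ereal l"
    using b_le by (intro antisym) (auto simp: mp_dot_le_iff rmax h)
  \<comment> \<open>At \<open>i\<close> the upper bound is an equality, on \<open>Argmax b x\<close>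
    the lower one is; the opposite bound follows from \<alpha> < \<beta>.\<close>
  have "x k - ereal \<beta> + ereal l \<le> h k \<and> h k \<le> x k - ereal \<alpha> + ereal l" for k
  proof -
    consider "k = i" | "k \<in> Argmax b x" | "k \<noteq> i" "k \<notin> Argmax b x" by blast
    then show ?thesis
    proof cases
      case 1
      then show ?thesis using ai axi less by (cases "a i"; cases "x i"; cases "h i") auto
    next
      case 2
      then show ?thesis using bj[of k] bxj[of k] less
        by (cases "b k"; cases "x k"; cases "h k") auto
    next
      case 3
      then show ?thesis
        using rest[of k] P_le by (meson order_trans)
    qed
  qed
  then show "optimal h"
    by (simp add: optimal_def ax bx ah bh)
qed

end

section \<open>From the original hypotheses to real products, and the final equivalence\<close>

lemma excluded_pointI:
  fixes a b x :: "'n::finite \<Rightarrow> ereal"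
  assumes rmax: "a \<in> rmax_vec" "b \<in> rmax_vec" "x \<in> rmax_vec"
    and supp: "Supp a \<inter> Supp b = {}"
    and "x \<notin> mp_halfspace a b" "hilbert_setdist x (mp_halfspace a b) < \<infinity>"
  obtains \<alpha> \<beta> where "excluded_point a b x \<alpha> \<beta>"
proof -
  have lt: "a \<odot> x < b \<odot> x"
    using assms(5) rmax by (simp add: mp_halfspace_def)
  then obtain \<beta> where \<beta>: "b \<odot> x = ereal \<beta>"
    using mp_dot_not_PInf[OF rmax(2,3)] by (cases "b \<odot> x") auto
  obtain j where j: "b j + x j = ereal \<beta>"
    using mp_dot_attained[OF rmax(2,3)] \<beta> by metis
  then have xj: "x j \<noteq> -\<infinity>"
    by (cases "b j") auto
  obtain h where h: "h \<in> rmax_vec" "b \<odot> h \<le> a \<odot> h" "hilbert_dist x h < \<infinity>"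
    using assms(6) unfolding hilbert_setdist_def INF_less_iff by (auto simp: mp_halfspace_def)
  obtain p q where "\<And>k. x k + ereal p \<le> h k" "\<And>k. h k + ereal q \<le> x k"
    using hilbert_dist_lessE[OF rmax(3) h(1) xj h(3)] by metis
  then have "b \<odot> x + ereal p \<le> b \<odot> h" "a \<odot> h + ereal q \<le> a \<odot> x"
    using rmax h(1) by (auto intro: mp_dot_shift_le)
  \<comment> \<open>Finite distance is what keeps \<open>a \<odot> x\<close> above
    \<open>-\<infinity>\<close>: the real \<beta> bounds \<open>b \<odot> h\<close>, then
    \<open>a \<odot> h\<close>, then \<open>a \<odot> x\<close> from below up to real
    shifts.\<close>
  then obtain \<alpha> where \<alpha>: "a \<odot> x = ereal \<alpha>"
    using \<beta> lt h(2) by (cases "a \<odot> x"; cases "a \<odot> h"; cases "b \<odot> h") auto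
  have "a k = -\<infinity> \<or> b k = -\<infinity>" for k
    using supp[unfolded disjoint_iff, rule_format, of k] rmax_vecD[OF rmax(1), of k] rmax_vecD[OF rmax(2), of k]
    by (cases "a k"; cases "b k") (auto simp: Supp_def)
  then have "excluded_point a b x \<alpha> \<beta>"
    using rmax \<alpha> \<beta> lt by unfold_locales auto
  then show thesis by (rule that)
qed

theorem theorem7p1:
  fixes a b x h :: "'n::finite \<Rightarrow> ereal" and H :: "('n \<Rightarrow> ereal) set"
  assumes "a \<in> rmax_vec" and "b \<in> rmax_vec"
    and "H = mp_halfspace a b"
    and "Supp a \<inter> Supp b = {}" and "Supp b \<noteq> {}"
    and "x \<in> rmax_vec" and "x \<notin> H" and "hilbert_setdist x H < \<infinity>"
    and "h \<in> rmax_vec"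
  shows "let assertion1 = best_approximation x H h;
             assertion2 = (a \<odot> h \<ge> b \<odot> h \<and> b \<odot> h \<noteq> -\<infinity> \<and>
               (\<forall>k. x k - b \<odot> x + a \<odot> h \<le> h k \<and> h k \<le> x k - a \<odot> x + b \<odot> h));
             conditions3 = (\<lambda>(l::real) i.
               a i + h i = ereal l \<and>
               (\<forall>j\<in>Argmax b x. b j + h j = ereal l) \<and>
               (\<forall>k\<in>UNIV - (Argmax b x \<union> {i}).
                  x k - b \<odot> x + ereal l \<le> h k \<and>
                  h k \<le> canonical_proj H x k - a \<odot> x + ereal l));
             assertion3 = (\<exists>l. \<exists>i\<in>Argmax a x. conditions3 l i)
         in (assertion1 \<longleftrightarrow> assertion2) \<and> (assertion2 \<longleftrightarrow> assertion3) \<and>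
            (\<forall>l. \<forall>i\<in>Argmax a x. conditions3 l i \<longrightarrow> ereal l = a \<odot> h \<and> ereal l = b \<odot> h)"
proof -
  obtain \<alpha> \<beta> where "excluded_point a b x \<alpha> \<beta>"
    using excluded_pointI assms by metis
  then interpret excluded_point a b x \<alpha> \<beta> .
  have H: "H = mp_halfspace a b" by fact
  have "best_approximation x H h \<longleftrightarrow> optimal h"
    using best_approximation_iff_optimal[OF assms(9)] H by simp
  moreover have "optimal h \<longleftrightarrow> (\<exists>l. \<exists>i\<in>Argmax a x. saturated h l i)"
    using optimal_imp_saturated saturated_imp_optimal(3) assms(9) by blast
  moreover have "\<forall>l. \<forall>i\<in>Argmax a x. saturated h l i \<longrightarrow> ereal l = a \<odot> h \<and> ereal l = b \<odot> h"
    using saturated_imp_optimal(1,2)[OF assms(9)] by metis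
  ultimately show ?thesis
    unfolding Let_def optimal_def saturated_def H by blast
qed

end
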